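(* As an identity of formal power series in $x,y,q$, \begin{align*} \frac{(-x;q)_\infty (xy;q)_\infty}{(x^2yq^2;q^2)_\infty} = \sum_{n\ge 0} \frac{x^n q^{\binom{n}{2}}(1-x^2y^2q^{4n})(xy;q)_n (y;q^2)_n}{(q;q)_n(x^2yq^2;q^2)_n}. \end{align*}
   Context: For $n\in\mathbb{N}\cup\{\infty\}$, $(A;q)_n:=\prod_{k=0}^{n-1}(1-Aq^k)$. *)

theory Defs
  imports "HOL-Analysis.Analysis" "HOL-Library.Extended_Nat"
begin

text \<open>
  Formal power series in \<open>x\<close>, \<open>y\<close>, \<open>q\<close> over a field \<open>'a\<close> are modelled as \<open>'a fps fps fps\<close>, read as
  \<open>'a[[x]][[y]][[q]]\<close>: \<open>q\<close> is the outermost variable. The library topology on this type is the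
  \<open>q\<close>-adic one, with coefficients in \<open>'a[[x]][[y]]\<close> discrete. It is finer than the
  \<open>(x,y,q)\<close>-adic topology, so limits, infinite sums and infinite products taken in it agree with
  the coefficientwise ones. Division by a series whose \<open>q\<close>-constant coefficient is \<open>1\<close> is
  multiplication by its inverse.
\<close>

definition x_var :: "'a::field fps fps fps" where
  "x_var = fps_const (fps_const fps_X)"

definition y_var :: "'a::field fps fps fps" where
  "y_var = fps_const fps_X"

definition q_var :: "'a::field fps fps fps" where
  "q_var = fps_X"

definition q_pochhammer :: "'b::{t2_space,comm_ring_1} \<Rightarrow> 'b \<Rightarrow> enat \<Rightarrow> 'b" where
  "q_pochhammer A q n =
     (case n of enat m \<Rightarrow> (\<Prod>k<m. 1 - A * q ^ k) | \<infinity> \<Rightarrow> (\<Prod>k. 1 - A * q ^ k))"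

end

theory Submission
  imports Defs
begin

unbundle no vec_syntax
unbundle fps_syntax

text \<open>
  Write \<open>t n X\<close> for the summand at \<open>x = X\<close> and \<open>S M X\<close> for its partial sums. A \<open>q\<close>-Zeilberger
  certificate \<open>G\<close> shows that \<open>(1 - X\<^sup>2 y q\<^sup>2) t n X - (1 + X) (1 - X y) t n (X q)\<close> telescopes,
  with \<open>G 0 = 0\<close> and \<open>G M\<close> divisible by \<open>q\<close> to the power \<open>M choose 2\<close>. Iterating \<open>X \<mapsto> X q\<close>
  from \<open>X = x\<close>, \<open>M\<close> times, relates \<open>S M x\<close> to \<open>S M (x q^M)\<close>, which is \<open>1\<close> modulo \<open>q^M\<close>. Hence the
  identity with denominators cleared and with all infinite expressions truncated at \<open>M\<close> holds modulo
  \<open>q^(M - 1)\<close>, for every \<open>M > 0\<close>.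
\<close>

section \<open>Congruences modulo powers of the variable, and infinite products\<close>

lemma fps_X_power_dvd_iff:
  fixes f :: "'b::comm_ring_1 fps"
  shows "fps_X ^ m dvd f \<longleftrightarrow> (\<forall>k<m. f $ k = 0)"
proof
  assume "fps_X ^ m dvd f"
  then show "\<forall>k<m. f $ k = 0"
    by (auto simp: fps_X_power_mult_nth)
next
  assume "\<forall>k<m. f $ k = 0"
  then have "f = fps_X ^ m * fps_shift m f"
    by (auto simp: fps_eq_iff fps_X_power_mult_nth)
  then show "fps_X ^ m dvd f"
    by (rule dvdI)
qed

lemma q_pochhammer_0 [simp]: "q_pochhammer A q (enat 0) = 1"
  by (simp add: q_pochhammer_def)

lemma q_pochhammer_Suc:
  "q_pochhammer A q (enat (Suc n)) = q_pochhammer A q (enat n) * (1 - A * q ^ n)"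
  by (simp add: q_pochhammer_def)

text \<open>Both sides are the product of the first \<open>n + 1\<close> factors, with the first one
  or the last one split off.\<close>

lemma q_pochhammer_shift:
  "(1 - A) * q_pochhammer (A * q) q (enat n) = q_pochhammer A q (enat n) * (1 - A * q ^ n)"
  by (induction n) (simp_all add: q_pochhammer_Suc mult.assoc flip: mult.assoc[of "1 - A"])

lemma q_pochhammer_nth_0:
  fixes A Q :: "'b::comm_ring_1 fps"
  assumes "A $ 0 = 0"
  shows "q_pochhammer A Q (enat n) $ 0 = 1"
  by (induction n) (simp_all add: q_pochhammer_Suc assms)

text \<open>Every factor of index at least \<open>m\<close> is 1 modulo \<open>fps_X ^ m\<close>, so
  each coefficient of the finite products is eventually constant.\<close>

lemma q_pochhammer_infinity_cong:
  fixes A Q :: "'b::idom fps"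
  assumes Q: "fps_X dvd Q" and A: "A $ 0 \<noteq> 1"
  shows "fps_X ^ m dvd q_pochhammer A Q \<infinity> - q_pochhammer A Q (enat m)"
proof -
  define P where "P m = q_pochhammer A Q (enat m)" for m
  define L where "L = Abs_fps (\<lambda>k. P (Suc k) $ k)"
  have "fps_X ^ m dvd P (m + j) - P m" for m j
  proof (induction j)
    case (Suc j)
    have "fps_X ^ m dvd Q ^ (m + j)"
      using Q by (meson dvd_power_same le_add1 le_imp_power_dvd dvd_trans)
    then have "fps_X ^ m dvd (P (m + j) - P m) - P (m + j) * A * Q ^ (m + j)"
      by (rule dvd_diff[OF Suc dvd_mult])
    then show ?case
      by (simp add: P_def q_pochhammer_Suc algebra_simps)
  qed simp
  then have P_cong: "fps_X ^ m dvd P n - P m" if "m \<le> n" for m n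
    using that by (metis le_add_diff_inverse)
  have P_nth: "P n $ k = L $ k" if "k < n" for k n
    using P_cong[of "Suc k" n] that by (simp add: fps_X_power_dvd_iff L_def del: power_Suc)
  have "P \<longlonglongrightarrow> L"
    by (intro tendsto_fpsI eventually_mono[OF eventually_gt_at_top] P_nth)
  then have "(\<lambda>n. \<Prod>k\<le>n. 1 - A * Q ^ k) \<longlonglongrightarrow> L"
    by (subst (asm) filterlim_sequentially_Suc[symmetric])
       (simp add: P_def q_pochhammer_def lessThan_Suc_atMost)
  \<comment> \<open>\<open>raw_has_prod\<close> demands a nonzero limit; here
    \<open>L $ 0 = 1 - A $ 0\<close>.\<close>
  moreover have "L $ 0 \<noteq> 0"
    using A by (simp add: L_def P_def q_pochhammer_Suc)
  ultimately have "(\<lambda>k. 1 - A * Q ^ k) has_prod L"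
    by (auto simp: has_prod_def raw_has_prod_def)
  then have "q_pochhammer A Q \<infinity> = L"
    by (simp add: q_pochhammer_def has_prod_unique[symmetric])
  then show ?thesis
    unfolding fps_X_power_dvd_iff using P_nth by (simp add: P_def)
qed

section \<open>Inverses of series with constant coefficient 1\<close>

lemma fps_unit_mult_inverse:
  fixes f :: "'a::field fps fps fps"
  assumes "f $ 0 = 1"
  shows "f * inverse f = 1"
proof -
  have "inverse (f $ 0) = 1"
    using assms by (simp add: fps_inverse_one')
  then show ?thesis
    using assms by (simp add: fps_inverse_def fps_right_inverse)
qed

lemma fps_inverse_mult_cancel:
  fixes f g h :: "'a::field fps fps fps"
  assumes "f * g = h" and "f $ 0 = 1" and "h $ 0 = 1"
  shows "inverse f = g * inverse h"
proof -
  have "inverse f = inverse f * (f * g * inverse h)"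
    using assms(1) fps_unit_mult_inverse[OF assms(3)] by simp
  also have "\<dots> = (f * inverse f) * (g * inverse h)"
    by (simp add: mult_ac)
  finally show ?thesis
    using fps_unit_mult_inverse[OF assms(2)] by simp
qed

section \<open>The summand and its certificate\<close>

definition summand :: "'a::field fps fps fps \<Rightarrow> 'a fps fps fps \<Rightarrow> nat \<Rightarrow> 'a fps fps fps \<Rightarrow> 'a fps fps fps"
  where "summand y q n x = x ^ n * q ^ (n choose 2) * (1 - x^2 * y^2 * q ^ (4 * n))
           * q_pochhammer (x * y) q (enat n) * q_pochhammer y (q^2) (enat n)
           * (inverse (q_pochhammer q q (enat n)) * inverse (q_pochhammer (x^2 * y * q^2) (q^2) (enat n)))"

text \<open>The denominators are those of \<open>summand y q n (x * q)\<close>, since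
  \<open>x * q\<close> turns \<open>x^2 * y * q^2\<close> into \<open>x^2 * y * q^4\<close>.\<close>

definition certificate :: "'a::field fps fps fps \<Rightarrow> 'a fps fps fps \<Rightarrow> nat \<Rightarrow> 'a fps fps fps \<Rightarrow> 'a fps fps fps"
  where "certificate y q n x = - (x ^ n * q ^ (n choose 2)
           * q_pochhammer (x * y) q (enat n) * q_pochhammer y (q^2) (enat n)
           * (inverse (q_pochhammer q q (enat n)) * inverse (q_pochhammer (x^2 * y * q^4) (q^2) (enat n)))
           * (1 - q ^ n) * (1 - x^2 * y * q ^ (2 * n + 2)) * (1 + x * y * q ^ (2 * n)))"

text \<open>All four terms are multiples of one common \<open>K\<close>; the cofactors satisfy a
  polynomial identity in \<open>x\<close>, \<open>y\<close>, \<open>q\<close> and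
  \<open>Q = q ^ n\<close>.\<close>

lemma certificate_step:
  fixes x y q :: "'a::field fps fps fps"
  assumes q0: "q $ 0 = 0"
  shows "(1 - x^2 * y * q^2) * summand y q n x - (1 + x) * (1 - x * y) * summand y q n (x * q)
           = certificate y q (Suc n) x - certificate y q n x"
proof -
  define Q where "Q = q ^ n"
  define a where "a = q_pochhammer (x * y) q (enat n)"
  define a' where "a' = q_pochhammer (x * q * y) q (enat n)"
  define b where "b = q_pochhammer y (q^2) (enat n)"
  define c where "c = inverse (q_pochhammer q q (enat n))"
  define c' where "c' = inverse (q_pochhammer q q (enat (Suc n)))"
  define d where "d = inverse (q_pochhammer (x^2 * y * q^2) (q^2) (enat n))"
  define e where "e = inverse (q_pochhammer (x^2 * y * q^4) (q^2) (enat n))"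
  define e' where "e' = inverse (q_pochhammer (x^2 * y * q^4) (q^2) (enat (Suc n)))"
  define p where "p = x ^ n * q ^ (n choose 2)"
  have q_powers: "q ^ (4 * n) = Q ^ 4" "q ^ (2 * n) = Q ^ 2" "q ^ (2 * n + 2) = Q^2 * q^2"
    "(q^2) ^ n = Q ^ 2" "q ^ Suc n = q * Q"
    by (simp_all add: Q_def mult.commute power_add flip: power_mult) (simp add: power2_eq_square)
  have p_Suc: "x ^ Suc n * q ^ (Suc n choose 2) = p * x * Q"
    by (simp add: p_def Q_def numeral_2_eq_2 power_add)
  have p_shift: "(x * q) ^ n * q ^ (n choose 2) = p * Q"
    by (simp add: p_def Q_def power_mult_distrib)
  have a': "(1 - x * y) * a' = a * (1 - x * y * Q)"
    using q_pochhammer_shift[of "x * y" q n] by (simp add: a_def a'_def Q_def mult_ac)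
  have c: "c = (1 - q * Q) * c'"
    unfolding c_def c'_def by (rule fps_inverse_mult_cancel)
      (simp_all add: q_pochhammer_Suc q_pochhammer_nth_0 q0 Q_def del: power_Suc)
  have e: "e = (1 - x^2 * y * q^4 * Q^2) * e'"
    unfolding e_def e'_def by (rule fps_inverse_mult_cancel)
      (simp_all add: q_pochhammer_Suc q_pochhammer_nth_0 q0 q_powers)
  have D: "q_pochhammer (x^2 * y * q^2) (q^2) (enat n) * (1 - x^2 * y * q^2 * Q^2)
      = (1 - x^2 * y * q^2) * q_pochhammer (x^2 * y * q^4) (q^2) (enat n)" (is "?D * ?g = ?f * ?E")
    using q_pochhammer_shift[of "x^2 * y * q^2" "q^2" n]
    by (simp add: q_powers mult.assoc flip: power_add)
  have "?D * d = 1" "?E * e = 1"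
    unfolding d_def e_def by (simp_all add: fps_unit_mult_inverse q_pochhammer_nth_0 q0)
  \<comment> \<open>The denominators in \<open>D\<close> are cleared by inserting the units
    \<open>?E * e\<close> and \<open>?D * d\<close>.\<close>
  then have "?f * d = ?f * d * (?E * e)" and "?g * e = ?g * e * (?D * d)"
    by (simp_all only: mult_1_right)
  moreover have "?f * d * (?E * e) = ?f * ?E * d * e" "?g * e * (?D * d) = ?D * ?g * d * e"
    by (simp_all only: mult_ac)
  ultimately have d: "?f * d = ?g * e"
    by (simp only: D)
  define K where "K = p * a * b * c * e"
  have "?f * summand y q n x = p * (1 - x^2 * y^2 * Q^4) * a * b * c * (?f * d)"
    unfolding summand_def q_powers p_def a_def b_def c_def d_def by (simp only: mult_ac)
  then have 1: "?f * summand y q n x = K * ((1 - x^2 * y^2 * Q^4) * ?g)"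
    unfolding d K_def by (simp add: mult_ac)
  have "(1 + x) * (1 - x * y) * summand y q n (x * q)
      = (1 + x) * (p * Q) * (1 - x^2 * y^2 * q^2 * Q^4) * ((1 - x * y) * a') * b * c * e"
    unfolding summand_def p_shift a'_def b_def c_def e_def q_powers
    by (simp add: power_mult_distrib mult_ac flip: power_add)
  then have 2: "(1 + x) * (1 - x * y) * summand y q n (x * q)
      = K * ((1 + x) * Q * (1 - x^2 * y^2 * q^2 * Q^4) * (1 - x * y * Q))"
    unfolding a' K_def by (simp add: mult_ac)
  have 3: "certificate y q n x = - (K * ((1 - Q) * ?g * (1 + x * y * Q^2)))"
    unfolding certificate_def K_def a_def[symmetric] b_def[symmetric] c_def[symmetric] e_def[symmetric]
      p_def[symmetric] q_powers Q_def[symmetric]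
    by (simp add: mult_ac)
  have Suc_powers: "q ^ (2 * Suc n + 2) = q^4 * Q^2" "q ^ (2 * Suc n) = q^2 * Q^2"
    by (simp_all add: Q_def power_add mult.commute power2_eq_square power4_eq_xxxx mult_2_right mult_ac)
  \<comment> \<open>The last factors of the two denominators at \<open>Suc n\<close> cancel against
    \<open>1 - q ^ n\<close> and \<open>1 - x^2 * y * q ^ (2 * n + 2)\<close> taken at
    \<open>Suc n\<close>; hence \<open>c\<close> and \<open>e\<close> are expanded through
    \<open>c'\<close> and \<open>e'\<close>.\<close>
  have 4: "certificate y q (Suc n) x
      = - (K * (x * Q * (1 - x * y * Q) * (1 - y * Q^2) * (1 + x * y * q^2 * Q^2)))"
    unfolding certificate_def K_def c e c'_def[symmetric] e'_def[symmetric] p_Suc Suc_powers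
    unfolding q_pochhammer_Suc a_def[symmetric] b_def[symmetric] q_powers Q_def[symmetric]
    by (simp add: mult_ac)
  \<comment> \<open>Here \<open>Q\<close> behaves as an independent variable.\<close>
  have core: "(1 - x^2 * y^2 * Q^4) * ?g - (1 + x) * Q * (1 - x^2 * y^2 * q^2 * Q^4) * (1 - x * y * Q)
    = (1 - Q) * ?g * (1 + x * y * Q^2)
      - x * Q * (1 - x * y * Q) * (1 - y * Q^2) * (1 + x * y * q^2 * Q^2)"
    by (simp add: algebra_simps power2_eq_square power4_eq_xxxx)
  have "K * s - K * t = - (K * v) - - (K * u)" if "s - t = u - v" for s t u v :: "'a fps fps fps"
    using that by (simp flip: right_diff_distrib)
  from this[OF core] show ?thesis
    unfolding 1 2 3 4 .
qed

section \<open>Functional equation of the partial sums modulo powers of q\<close>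

definition partial_sum :: "'a::field fps fps fps \<Rightarrow> 'a fps fps fps \<Rightarrow> nat \<Rightarrow> 'a fps fps fps \<Rightarrow> 'a fps fps fps"
  where "partial_sum y q M x = (\<Sum>n<M. summand y q n x)"

lemma partial_sum_step:
  fixes x y q :: "'a::field fps fps fps"
  assumes "q $ 0 = 0"
  shows "q ^ (M choose 2) dvd
           (1 - x^2 * y * q^2) * partial_sum y q M x - (1 + x) * (1 - x * y) * partial_sum y q M (x * q)"
proof -
  have "(1 - x^2 * y * q^2) * partial_sum y q M x - (1 + x) * (1 - x * y) * partial_sum y q M (x * q)
      = (\<Sum>n<M. certificate y q (Suc n) x - certificate y q n x)"
    by (simp add: partial_sum_def sum_distrib_left sum_subtractf certificate_step[OF assms, symmetric])
  also have "\<dots> = certificate y q M x"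
    \<comment> \<open>The lower boundary term vanishes through its factor
      \<open>1 - q ^ 0\<close>.\<close>
    by (subst sum_lessThan_telescope) (simp add: certificate_def)
  finally show ?thesis
    by (simp add: certificate_def)
qed

text \<open>The modulus in \<open>partial_sum_step\<close> does not depend on \<open>x\<close>, so
  no precision is lost in replacing \<open>x\<close> by \<open>x * q ^ N\<close>; the coefficients
  there are exactly the next factors of the three products.\<close>

lemma partial_sum_iterate:
  fixes x y q :: "'a::field fps fps fps"
  assumes "q $ 0 = 0"
  shows "q ^ (M choose 2) dvd
           q_pochhammer (x^2 * y * q^2) (q^2) (enat N) * partial_sum y q M x
           - q_pochhammer (- x) q (enat N) * q_pochhammer (x * y) q (enat N) * partial_sum y q M (x * q ^ N)"
    (is "?m dvd ?D N * ?S - ?A N * ?B N * ?T N")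
proof (induction N)
  case (Suc N)
  let ?g = "1 - x^2 * y * q^2 * (q^2) ^ N" and ?h = "(1 + x * q ^ N) * (1 - x * y * q ^ N)"
  have "(x * q ^ N)^2 * y * q^2 = x^2 * y * q^2 * (q^2) ^ N"
    by (simp add: power_mult_distrib power_mult[symmetric] mult_ac mult_2 mult_2_right power_add power2_eq_square)
  then have "?m dvd ?g * ?T N - ?h * ?T (Suc N)"
    using partial_sum_step[OF assms, of M "x * q ^ N" y] by (simp only: power_Suc2 mult_ac)
  then have "?m dvd ?g * (?D N * ?S - ?A N * ?B N * ?T N) + ?A N * ?B N * (?g * ?T N - ?h * ?T (Suc N))"
    using Suc by (intro dvd_add dvd_mult)
  also have "\<dots> = ?D (Suc N) * ?S - ?A (Suc N) * ?B (Suc N) * ?T (Suc N)"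
    unfolding q_pochhammer_Suc by (simp add: algebra_simps)
  finally show ?case .
qed simp

text \<open>The term at 0 is \<open>1 - x^2 * y^2\<close>, and every later one has a factor
  \<open>x\<close>. At \<open>x * q ^ M\<close> this gives a congruence modulo
  \<open>q ^ M\<close>.\<close>

lemma partial_sum_cong_1:
  fixes x y q :: "'a::field fps fps fps"
  assumes "M > 0"
  shows "x dvd partial_sum y q M x - 1"
proof -
  obtain K where M: "M = Suc K"
    using assms gr0_conv_Suc by blast
  have "inverse (1 :: 'a fps fps fps) = 1"
    using fps_unit_mult_inverse[of 1] by simp
  then have "partial_sum y q M x - 1 = (\<Sum>n<K. summand y q (Suc n) x) - x^2 * y^2"
    unfolding partial_sum_def M sum.lessThan_Suc_shift by (simp add: summand_def numeral_2_eq_2)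
  moreover have "x dvd summand y q (Suc n) x" for n
    by (simp add: summand_def)
  ultimately show ?thesis
    by (simp add: dvd_sum power2_eq_square)
qed

theorem theorem2p1:
  fixes x y q :: "'a::field fps fps fps"
  assumes "x = x_var" and "y = y_var" and "q = q_var"
  shows "(\<lambda>n. x ^ n * q ^ (n choose 2) * (1 - x^2 * y^2 * q ^ (4 * n))
              * q_pochhammer (x * y) q (enat n) * q_pochhammer y (q^2) (enat n)
              / (q_pochhammer q q (enat n) * q_pochhammer (x^2 * y * q^2) (q^2) (enat n)))
         sums
         (q_pochhammer (- x) q \<infinity> * q_pochhammer (x * y) q \<infinity>
              / q_pochhammer (x^2 * y * q^2) (q^2) \<infinity>)"
proof -
  have q: "q = fps_X"
    using assms by (simp add: q_var_def)
  then have q0: "q $ 0 = 0" by simp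
  have divide: "f / g = f * inverse g" if "g $ 0 = 1" for f g :: "'a fps fps fps"
    using that by (intro fps_divide_unit) simp
  let ?A = "q_pochhammer (- x) q" and ?B = "q_pochhammer (x * y) q"
    and ?D = "q_pochhammer (x^2 * y * q^2) (q^2)"
  \<comment> \<open>\<open>(- x) $ 0\<close> and \<open>(x * y) $ 0\<close> are nonzero series in
    the inner variables; their own constant coefficients distinguish them from 1.\<close>
  have const_nz: "(- x) $ 0 \<noteq> 1" "(x * y) $ 0 \<noteq> 1" "(x^2 * y * q^2) $ 0 \<noteq> 1"
  proof -
    have "(- x) $ 0 $ 0 $ 0 = 0" "(x * y) $ 0 $ 0 $ 0 = 0" "(x^2 * y * q^2) $ 0 $ 0 $ 0 = 0"
      using assms by (simp_all add: x_var_def y_var_def q_var_def)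
    then show "(- x) $ 0 \<noteq> 1" "(x * y) $ 0 \<noteq> 1" "(x^2 * y * q^2) $ 0 \<noteq> 1"
      by (metis fps_one_nth one_neq_zero)+
  qed
  have A: "q ^ m dvd ?A \<infinity> - ?A (enat m)" and B: "q ^ m dvd ?B \<infinity> - ?B (enat m)"
    and D: "q ^ m dvd ?D \<infinity> - ?D (enat m)" for m
    using const_nz unfolding q by (auto intro!: q_pochhammer_infinity_cong simp: power2_eq_square)
  have D0: "?D \<infinity> $ 0 = 1"
    using D[of 1] by (simp add: q fps_X_power_dvd_iff[of 1, simplified] q_pochhammer_nth_0)
  let ?L = "?A \<infinity> * ?B \<infinity> * inverse (?D \<infinity>)"
  have approx: "fps_X ^ (M - 1) dvd partial_sum y q M x - ?L" if "M > 0" for M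
  proof -
    let ?A' = "?A (enat M)" and ?B' = "?B (enat M)" and ?D' = "?D (enat M)" and ?S = "partial_sum y q M x"
      and ?T = "partial_sum y q M (x * q ^ M)"
    let ?m = "q ^ (M - 1)"
    \<comment> \<open>\<open>M - 1\<close> bounds both error exponents from below:
      \<open>M choose 2\<close> from the iteration and \<open>M\<close> from the
      truncations.\<close>
    have "M - 1 \<le> M choose 2"
      using \<open>M > 0\<close> by (cases M) (auto simp: numeral_2_eq_2)
    then have S: "?m dvd ?D' * ?S - ?A' * ?B' * ?T"
      using partial_sum_iterate[OF q0] by (meson dvd_trans le_imp_power_dvd)
    have T: "?m dvd ?T - 1"
      using partial_sum_cong_1[OF \<open>M > 0\<close>, of "x * q ^ M" y q]
      by (meson diff_le_self dvd_mult_right dvd_trans le_imp_power_dvd)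
    have "?m dvd q ^ M"
      by (simp add: le_imp_power_dvd)
    then have A': "?m dvd ?A \<infinity> - ?A'" and B': "?m dvd ?B \<infinity> - ?B'" and D': "?m dvd ?D \<infinity> - ?D'"
      using A B D dvd_trans by blast+
    \<comment> \<open>The five differences pass from \<open>?D \<infinity> * ?S\<close> to
      \<open>?A \<infinity> * ?B \<infinity>\<close> by replacing one factor at a time.\<close>
    have "?m dvd inverse (?D \<infinity>) * ((?D' * ?S - ?A' * ?B' * ?T) + ?A' * ?B' * (?T - 1)
        + ?S * (?D \<infinity> - ?D') - ?B' * (?A \<infinity> - ?A') - ?A \<infinity> * (?B \<infinity> - ?B'))"
      by (rule dvd_mult[OF dvd_diff[OF dvd_diff[OF dvd_add[OF dvd_add[OF S dvd_mult[OF T]]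
            dvd_mult[OF D']] dvd_mult[OF A']] dvd_mult[OF B']]])
    also have "\<dots> = ?S * (?D \<infinity> * inverse (?D \<infinity>)) - ?L"
      by (simp add: algebra_simps)
    finally show ?thesis
      by (simp only: fps_unit_mult_inverse[OF D0[unfolded q]] q mult_1_right)
  qed
  have "(\<lambda>M. partial_sum y q M x) \<longlonglongrightarrow> ?L"
  proof (rule tendsto_fpsI, rule eventually_sequentiallyI)
    fix n M :: nat
    assume "n + 2 \<le> M"
    then show "partial_sum y q M x $ n = ?L $ n"
      using approx[of M] by (auto simp: fps_X_power_dvd_iff)
  qed
  then have "(\<lambda>n. summand y q n x) sums ?L"
    by (simp add: sums_def partial_sum_def)
  \<comment> \<open>The theorem divides by a product, while \<open>summand\<close> multiplies two
    inverses.\<close>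
  moreover have "inverse (f * g) = inverse f * inverse g" if "f $ 0 = 1" "g $ 0 = 1"
    for f g :: "'a fps fps fps"
  proof -
    have "inverse g = f * inverse (f * g)"
      using that by (intro fps_inverse_mult_cancel) (simp_all add: mult.commute)
    then have "inverse f * inverse g = f * inverse f * inverse (f * g)"
      by (simp add: mult_ac)
    then show ?thesis
      using that by (simp add: fps_unit_mult_inverse)
  qed
  ultimately show ?thesis
    by (simp add: divide D0 q_pochhammer_nth_0 q0 summand_def[abs_def])
qed

end
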